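(* Let $n\geq 2$ be fixed and let $K_n'$ be the dual of the complete graph $K_n$. Run the CU-process on $K_n'$ in the $N$-uniform model (respectively, in the $N$-balanced model). Then, in each of the two models, the counter of each vertex $v$ of $K_n'$ satisfies $c_v^{(N)}/N=\frac{n}{n-1}+o(1)$ with high probability as $N\to\infty$. Hence the relative error of each edge $e$ of $K_n'$ satisfies $R_e^{(N)}=\frac{1}{n-1}+o(1)$ with high probability as $N\to\infty$. (Here "$X_N=c+o(1)$ with high probability as $N\to\infty$" means that for every $\epsilon>0$, $\mathbb{P}(|X_N-c|\leq\epsilon)\to 1$ as $N\to\infty$.)
   Context: The dual of a hypergraph $H$ is the hypergraph $H'$ in which the roles of vertices and edges are interchanged: its vertices are the edges of $H$, and its edges are indexed by the vertices of $H$, the edge corresponding to a vertex $v$ of $H$ consisting of the edges of $H$ incident to $v$. Thus $K_n'$ has $\binom n2$ vertices (the pairs $\{i,j\}\subset\{1,\dots,n\}$) and $n$ edges $e_1,\dots,e_n$, where $e_i$ is the set of all pairs containing $i$ (edges are regarded as distinct when their indices are distinct); each edge contains $n-1$ vertices and each vertex lies in exactly two edges. CU-process on a hypergraph $H=(V,E)$: each vertex $v$ carries a counter $c_v$ with initial value $0$. At each step an edge $e\in E$ is drawn, and those $c_v$, $v\in e$, with $c_v=\min_{u\in e}c_u$ (values before the step) are simultaneously incremented by $1$; the other counters do not change. $c_v(t)$ is the value of $c_v$ after $t$ steps, $o_e(t)$ is the number of times $e$ was drawn in the first $t$ steps, $c_e(t)=\min_{v\in e}c_v(t)$, and $R_e(t)=\frac{c_e(t)-o_e(t)}{o_e(t)}$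 (set to $+\infty$ if $o_e(t)=0$). Models, with $m=|E|$ (here $m=n$) and $N\geq1$ an integer: in the $N$-uniform model, the process runs for $Nm$ steps, the edge at each step being drawn independently and uniformly from $E$; in the $N$-balanced model, the sequence of $Nm$ drawn edges is a uniformly random permutation of the multiset containing $N$ copies of each edge. In both, $c_v^{(N)}=c_v(Nm)$ and $R_e^{(N)}=R_e(Nm)$. *)

theory Defs
  imports "HOL-Probability.Probability" "HOL-Combinatorics.Multiset_Permutations"
begin

text \<open>Edges are indices, and \<open>incidence H e\<close> is the set of vertices contained in the edge \<open>e\<close>.
  Two edges with different indices are different, even if they contain the same vertices; this
  matters already for the dual of the complete graph on two vertices.\<close>

record ('v, 'e) hypergraph =
  vertices :: "'v set"
  edges :: "'e set"
  incidence :: "'e \<Rightarrow> 'v set"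

definition dual :: "('v, 'e) hypergraph \<Rightarrow> ('e, 'v) hypergraph" where
  "dual H = \<lparr>vertices = edges H, edges = vertices H,
     incidence = (\<lambda>v. {e \<in> edges H. v \<in> incidence H e})\<rparr>"

definition complete_graph_K :: "nat \<Rightarrow> (nat, nat set) hypergraph" where
  "complete_graph_K n = \<lparr>vertices = {1..n},
     edges = {{i, j} | i j. i \<in> {1..n} \<and> j \<in> {1..n} \<and> i \<noteq> j},
     incidence = (\<lambda>e. e)\<rparr>"

definition edge_min :: "('v, 'e) hypergraph \<Rightarrow> ('v \<Rightarrow> nat) \<Rightarrow> 'e \<Rightarrow> nat" where
  "edge_min H c e = Min (c ` incidence H e)"

definition cu_step :: "('v, 'e) hypergraph \<Rightarrow> 'e \<Rightarrow> ('v \<Rightarrow> nat) \<Rightarrow> ('v \<Rightarrow> nat)" where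
  "cu_step H e c = (\<lambda>v. if v \<in> incidence H e \<and> c v = edge_min H c e then c v + 1 else c v)"

text \<open>In the following, \<open>es\<close> is the sequence of drawn edges and \<open>t\<close> the number of steps
  performed, with \<open>t \<le> length es\<close>.\<close>

definition vertex_counter :: "('v, 'e) hypergraph \<Rightarrow> 'e list \<Rightarrow> nat \<Rightarrow> 'v \<Rightarrow> nat" where
  "vertex_counter H es t = fold (cu_step H) (take t es) (\<lambda>_. 0)"

definition draw_count :: "'e list \<Rightarrow> nat \<Rightarrow> 'e \<Rightarrow> nat" where
  "draw_count es t e = count_list (take t es) e"

definition edge_counter :: "('v, 'e) hypergraph \<Rightarrow> 'e list \<Rightarrow> nat \<Rightarrow> 'e \<Rightarrow> nat" where
  "edge_counter H es t e = edge_min H (vertex_counter H es t) e"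

definition relative_error :: "('v, 'e) hypergraph \<Rightarrow> 'e list \<Rightarrow> nat \<Rightarrow> 'e \<Rightarrow> ereal" where
  "relative_error H es t e =
     (if draw_count es t e = 0 then \<infinity>
      else ereal ((real (edge_counter H es t e) - real (draw_count es t e))
                  / real (draw_count es t e)))"

definition num_steps :: "('v, 'e) hypergraph \<Rightarrow> nat \<Rightarrow> nat" where
  "num_steps H N = N * card (edges H)"

definition uniform_model :: "('v, 'e) hypergraph \<Rightarrow> nat \<Rightarrow> 'e list pmf" where
  "uniform_model H N = replicate_pmf (num_steps H N) (pmf_of_set (edges H))"

definition balanced_model :: "('v, 'e) hypergraph \<Rightarrow> nat \<Rightarrow> 'e list pmf" where
  "balanced_model H N =
     pmf_of_set (permutations_of_multiset (\<Sum>e\<in>edges H. replicate_mset N e))"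

text \<open>\<open>whp_limit p X c\<close> says that \<open>X N = c + o(1)\<close> with high probability as \<open>N\<close> tends to infinity,
  where \<open>X N\<close> is a random variable on the probability space \<open>p N\<close>. An infinite value of \<open>X N\<close>
  is at infinite distance from \<open>c\<close>.\<close>

definition whp_limit :: "(nat \<Rightarrow> 'a pmf) \<Rightarrow> (nat \<Rightarrow> 'a \<Rightarrow> ereal) \<Rightarrow> real \<Rightarrow> bool" where
  "whp_limit p X c \<longleftrightarrow>
     (\<forall>\<epsilon>>0. (\<lambda>N. measure_pmf.prob (p N) {\<omega>. \<bar>X N \<omega> - ereal c\<bar> \<le> ereal \<epsilon>}) \<longlonglongrightarrow> 1)"

end

theory Submission
  imports Defs "HOL-Real_Asymp.Real_Asymp"
begin

text \<open>The counters always have the form \<open>c {i, j} = max (y i) (y j)\<close>, where the heights \<open>y\<close> evolve as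
  follows: drawing \<open>i\<close> raises \<open>y i\<close> by one, and if only one edge is left at the lowest level \<open>M\<close>,
  then that edge is lifted by one as well. So \<open>M\<close> increases exactly when a lift occurs, and after
  \<open>t\<close> draws the heights add up to \<open>t + M\<close>. If all heights stay within \<open>o(N)\<close> of \<open>M\<close>, then
  \<open>n M = N n + M + o(N)\<close>, that is, \<open>M / N\<close> tends to \<open>n / (n - 1)\<close>.

  The heights stay together whenever every draw count is close to its mean at all times: two edges
  are always at level \<open>M\<close>, and a set of \<open>k \<ge> 2\<close> edges close to \<open>M\<close> makes \<open>M\<close> grow faster than the
  draw count of any other edge, so that another edge is close to \<open>M\<close> too.

  In the uniform model, Hoeffding's inequality bounds the probability of a large deviation by an
  exponentially small quantity. The balanced model is the uniform model conditioned on the most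
  likely vector of draw counts, whose probability is at least \<open>(N n + 1) ^ (-n)\<close>; hence the
  bound survives the conditioning.\<close>

subsection \<open>Reduction to one height per edge\<close>

definition low :: "'a set \<Rightarrow> ('a \<Rightarrow> nat) \<Rightarrow> nat" where
  "low V y = Min (y ` V)"

definition tied :: "'a set \<Rightarrow> ('a \<Rightarrow> nat) \<Rightarrow> bool" where
  "tied V y \<longleftrightarrow> 2 \<le> card {j \<in> V. y j = low V y}"

text \<open>The height of an edge that is the only lowest one is invisible in the counters
  \<open>max (y i) (y j)\<close>. Raising it to the second lowest height, here always one level up, keeps
  the state tied.\<close>

definition climb :: "'a set \<Rightarrow> 'a \<Rightarrow> ('a \<Rightarrow> nat) \<Rightarrow> ('a \<Rightarrow> nat)" where
  "climb V i y = (let z = y(i := y i + 1) in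
     if card {j \<in> V. z j = low V y} = 1
     then (\<lambda>j. if j \<in> V \<and> z j = low V y then z j + 1 else z j) else z)"

lemma low_le: "finite V \<Longrightarrow> k \<in> V \<Longrightarrow> low V y \<le> y k"
  by (simp add: low_def)

lemma low_eqI: "finite V \<Longrightarrow> k \<in> V \<Longrightarrow> y k = m \<Longrightarrow> (\<And>j. j \<in> V \<Longrightarrow> m \<le> y j) \<Longrightarrow> low V y = m"
  unfolding low_def by (rule Min_eqI) auto

lemma low_const_0:
  assumes "finite V" "2 \<le> card V"
  shows "low V (\<lambda>_. 0) = 0"
proof -
  have "V \<noteq> {}" using assms by auto
  then show ?thesis by (simp add: low_def image_constant_conv)
qed

lemma tiedI:
  assumes "finite V" "i \<in> V" "j \<in> V" "i \<noteq> j" "y i = low V y" "y j = low V y"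
  shows "tied V y"
proof -
  have "card {i, j} \<le> card {j \<in> V. y j = low V y}"
    by (rule card_mono) (use assms in auto)
  then show ?thesis using assms by (simp add: tied_def)
qed

lemma tied_other:
  assumes "finite V" "tied V y"
  obtains j where "j \<in> V" "j \<noteq> i" "y j = low V y"
proof -
  have "\<not> {j \<in> V. y j = low V y} \<subseteq> {i}"
  proof
    assume "{j \<in> V. y j = low V y} \<subseteq> {i}"
    then have "card {j \<in> V. y j = low V y} \<le> card {i}" by (intro card_mono) auto
    then show False using assms by (simp add: tied_def)
  qed
  then show ?thesis using that by auto
qed

text \<open>At least two edges are lowest before the draw and only \<open>i\<close> can leave that
  level, so at least one stays. If two or more stay, nothing is lifted. If just \<open>j\<close>
  stays, then \<open>i\<close> and \<open>j\<close> were the only lowest edges, and after the lift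
  both sit at the new lowest level.\<close>

lemma climb_cases:
  assumes V: "finite V" and tied: "tied V y" and i: "i \<in> V"
  obtains
    (free) "climb V i y = y(i := y i + 1)" "low V (climb V i y) = low V y" "tied V (climb V i y)"
  | (lift) j where "j \<in> V" "j \<noteq> i" "y i = low V y" "y j = low V y"
      "\<And>k. k \<in> V \<Longrightarrow> k \<noteq> i \<Longrightarrow> k \<noteq> j \<Longrightarrow> low V y < y k"
      "climb V i y = y(i := y i + 1, j := y j + 1)"
      "low V (climb V i y) = low V y + 1" "tied V (climb V i y)"
proof -
  define m where "m = low V y"
  define Z where "Z = {j \<in> V. y j = m}"
  define z where "z = y(i := y i + 1)"
  have ge: "m \<le> y k" if "k \<in> V" for k using low_le[OF V that] by (simp add: m_def)
  have finZ: "finite Z" using V by (simp add: Z_def)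
  have Z2: "2 \<le> card Z" using tied by (simp add: tied_def Z_def m_def)
  have eqZ: "{j \<in> V. z j = m} = Z - {i}"
    using ge[OF i] by (auto simp: Z_def z_def)
  have cl: "climb V i y = (if card (Z - {i}) = 1
      then (\<lambda>j. if j \<in> V \<and> z j = m then z j + 1 else z j) else z)"
    unfolding climb_def Let_def z_def[symmetric] m_def[symmetric] eqZ ..
  show ?thesis
  proof (cases "card (Z - {i}) = 1")
    case True
    then obtain j where j: "Z - {i} = {j}" by (auto simp: card_1_singleton_iff)
    have iZ: "i \<in> Z"
    proof (rule ccontr)
      assume "i \<notin> Z"
      then have "Z = {j}" using j by auto
      then show False using Z2 by simp
    qed
    have jV: "j \<in> V" "j \<noteq> i" "y j = m" and yi: "y i = m"
      using j iZ by (auto simp: Z_def)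
    have gt: "m < y k" if "k \<in> V" "k \<noteq> i" "k \<noteq> j" for k
    proof -
      have "k \<notin> Z" using j that by auto
      then show ?thesis using ge[OF that(1)] that by (auto simp: Z_def)
    qed
    have c: "climb V i y = y(i := y i + 1, j := y j + 1)"
    proof
      fix k
      have "k \<in> V \<and> z k = m \<longleftrightarrow> k = j" using eqZ j by blast
      then show "climb V i y k = (y(i := y i + 1, j := y j + 1)) k"
        using True cl jV by (auto simp: z_def)
    qed
    have l: "low V (climb V i y) = m + 1"
      by (rule low_eqI[OF V i]) (use c jV yi gt in \<open>auto simp: Suc_le_eq\<close>)
    have t: "tied V (climb V i y)"
      by (rule tiedI[OF V i jV(1) jV(2)[symmetric]]) (use l c yi jV in auto)
    show ?thesis
      by (rule lift[of j]) (use jV yi gt c l t in \<open>auto simp: m_def\<close>)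
  next
    case False
    then have c: "climb V i y = z" using cl by simp
    \<comment> \<open>This excludes an empty remainder, so a cardinality other than 1 means at least
      2.\<close>
    have "card Z - 1 \<le> card (Z - {i})"
      using diff_card_le_card_Diff[of "{i}" Z] by simp
    then have c2: "2 \<le> card (Z - {i})" using Z2 False by linarith
    then obtain k where "k \<in> Z - {i}" by (metis card.empty ex_in_conv not_numeral_le_zero)
    then have k: "k \<in> V" "k \<noteq> i" "y k = m" by (auto simp: Z_def)
    have l: "low V z = m"
      by (rule low_eqI[OF V k(1)]) (use k ge in \<open>auto simp: z_def le_SucI\<close>)
    have "tied V z" unfolding tied_def l eqZ by (rule c2)
    then show ?thesis using free c l by (simp add: z_def m_def)
  qed
qed

section \<open>The counters as maxima of two heights\<close>

definition represents :: "nat set \<Rightarrow> (nat set \<Rightarrow> nat) \<Rightarrow> (nat \<Rightarrow> nat) \<Rightarrow> bool" where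
  "represents V c y \<longleftrightarrow> (\<forall>a\<in>V. \<forall>b\<in>V. a \<noteq> b \<longrightarrow> c {a, b} = max (y a) (y b))"

lemma edges_dual_complete: "edges (dual (complete_graph_K n)) = {1..n}"
  by (simp add: dual_def complete_graph_K_def)

lemma incidence_dual_complete:
  assumes "i \<in> {1..n}"
  shows "incidence (dual (complete_graph_K n)) i = (\<lambda>j. {i, j}) ` ({1..n} - {i})"
  using assms by (auto simp: dual_def complete_graph_K_def doubleton_eq_iff image_iff) blast+

text \<open>The values \<open>max (y i) (y k)\<close> with \<open>k\<close> different from
  \<open>i\<close> are at least \<open>y i\<close>, and a lowest edge other than \<open>i\<close>
  attains this; the tie guarantees that such an edge exists.\<close>

lemma edge_min_represents:
  assumes tied: "tied {1..n} y" and rep: "represents {1..n} c y" and i: "i \<in> {1..n}"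
  shows "edge_min (dual (complete_graph_K n)) c i = y i"
proof -
  obtain j where j: "j \<in> {1..n}" "j \<noteq> i" "y j = low {1..n} y"
    using tied_other[OF _ tied] by (metis finite_atLeastAtMost)
  have le: "y j \<le> y i" using j low_le[of "{1..n}" i y] i by simp
  have c: "c {i, k} = max (y i) (y k)" if "k \<in> {1..n} - {i}" for k
    using rep i that by (auto simp: represents_def)
  show ?thesis
    unfolding edge_min_def incidence_dual_complete[OF i]
  proof (rule Min_eqI)
    show "y i \<in> c ` (\<lambda>j. {i, j}) ` ({1..n} - {i})"
      using c[of j] j le by (intro image_eqI[of _ _ "{i, j}"]) auto
  next
    fix x assume "x \<in> c ` (\<lambda>j. {i, j}) ` ({1..n} - {i})"
    then obtain k where "k \<in> {1..n} - {i}" "x = c {i, k}" by blast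
    then show "y i \<le> x" using c by simp
  qed simp
qed

text \<open>Drawing \<open>i\<close> increments the counter of \<open>{i, b}\<close> exactly if
  \<open>y b\<close> is at most \<open>y i\<close>, just as raising \<open>y i\<close> does to the
  maximum. A lift of \<open>j\<close> changes no further counter: all other heights, including the
  raised one of \<open>i\<close>, already exceed the old level of \<open>j\<close>.\<close>

lemma represents_cu_step:
  assumes tied: "tied {1..n} y" and rep: "represents {1..n} c y" and i: "i \<in> {1..n}"
  shows "represents {1..n} (cu_step (dual (complete_graph_K n)) i c) (climb {1..n} i y)"
  unfolding represents_def
proof (intro ballI impI)
  fix a b assume ab: "a \<in> {1..n}" "b \<in> {1..n}" "a \<noteq> b"
  have c: "c {a, b} = max (y a) (y b)" using rep ab by (auto simp: represents_def)
  have inc: "{a, b} \<in> incidence (dual (complete_graph_K n)) i \<longleftrightarrow> a = i \<or> b = i"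
    unfolding incidence_dual_complete[OF i] using ab by (auto simp: doubleton_eq_iff)
  have step: "cu_step (dual (complete_graph_K n)) i c {a, b} =
      (if (a = i \<or> b = i) \<and> max (y a) (y b) = y i then max (y a) (y b) + 1 else max (y a) (y b))"
    by (simp add: cu_step_def inc edge_min_represents[OF assms] c)
  from finite_atLeastAtMost tied i show "cu_step (dual (complete_graph_K n)) i c {a, b} =
      max (climb {1..n} i y a) (climb {1..n} i y b)"
  proof (cases rule: climb_cases)
    case free
    then show ?thesis using ab step by auto
  next
    case (lift j)
    have cl: "climb {1..n} i y k = y k + (if k = i \<or> k = j then 1 else 0)" for k
      unfolding lift(6) using lift(2) by auto
    have gt: "k = i \<or> k = j \<or> y i < y k" "k = j \<longrightarrow> y k = y i" if "k \<in> {1..n}" for k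
      using lift(3,4) lift(5)[OF that] by auto
    consider "a = i" "b \<noteq> i" | "a \<noteq> i" "b = i" | "a \<noteq> i" "b \<noteq> i" using ab by blast
    then show ?thesis
      unfolding step cl using gt[OF ab(1)] gt[OF ab(2)] ab(3) 
      by cases (cases "a = j"; cases "b = j"; auto)+
  qed
qed

definition state :: "'a set \<Rightarrow> 'a list \<Rightarrow> nat \<Rightarrow> 'a \<Rightarrow> nat" where
  "state V es t = fold (climb V) (take t es) (\<lambda>_. 0)"

lemma state_0: "state V es 0 = (\<lambda>_. 0)"
  by (simp add: state_def)

lemma state_Suc: "t < length es \<Longrightarrow> state V es (Suc t) = climb V (es ! t) (state V es t)"
  by (simp add: state_def take_Suc_conv_app_nth)

lemma tied_state:
  assumes V: "finite V" "2 \<le> card V" and es: "set es \<subseteq> V" and t: "t \<le> length es"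
  shows "tied V (state V es t)"
  using t
proof (induction t)
  case 0
  show ?case using V by (simp add: state_0 tied_def low_const_0)
next
  case (Suc t)
  then have "tied V (state V es t)" "es ! t \<in> V" using es by (auto simp: subset_iff)
  with V(1) have "tied V (climb V (es ! t) (state V es t))"
    by (cases rule: climb_cases)
  then show ?case using Suc.prems by (simp add: state_Suc)
qed

lemma vertex_counter_state:
  assumes n: "2 \<le> n" and es: "set es \<subseteq> {1..n}" and t: "t \<le> length es"
  shows "represents {1..n} (vertex_counter (dual (complete_graph_K n)) es t) (state {1..n} es t)"
  using t
proof (induction t)
  case 0
  then show ?case by (simp add: represents_def vertex_counter_def state_0)
next
  case (Suc t)
  have "es ! t \<in> {1..n}" using Suc.prems es by (metis Suc_le_eq nth_mem subsetD)
  moreover have "tied {1..n} (state {1..n} es t)"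
    by (rule tied_state) (use n es Suc.prems in auto)
  moreover have "represents {1..n} (vertex_counter (dual (complete_graph_K n)) es t) (state {1..n} es t)"
    using Suc by simp
  ultimately have "represents {1..n}
      (cu_step (dual (complete_graph_K n)) (es ! t) (vertex_counter (dual (complete_graph_K n)) es t))
      (climb {1..n} (es ! t) (state {1..n} es t))"
    by (intro represents_cu_step)
  then show ?case
    using Suc.prems by (simp add: state_Suc vertex_counter_def take_Suc_conv_app_nth del: One_nat_def)
qed

section \<open>Growth of the heights compared with the draw counts\<close>

lemma draw_count_0: "draw_count es 0 i = 0"
  by (simp add: draw_count_def)

lemma draw_count_Suc:
  "t < length es \<Longrightarrow> draw_count es (Suc t) i = draw_count es t i + (if es ! t = i then 1 else 0)"
  by (simp add: draw_count_def take_Suc_conv_app_nth)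

definition excess :: "'a set \<Rightarrow> 'a list \<Rightarrow> nat \<Rightarrow> 'a \<Rightarrow> nat" where
  "excess V es t i = state V es t i - low V (state V es t)"

lemma state_eq_excess:
  "finite V \<Longrightarrow> i \<in> V \<Longrightarrow> state V es t i = excess V es t i + low V (state V es t)"
  using low_le[of V i "state V es t"] by (simp add: excess_def)

text \<open>A lifted edge lands on the new lowest level, so while no edge outside \<open>S\<close>
  is lowest, every lift goes to \<open>S\<close>. Hence edges outside \<open>S\<close> rise by their
  draws only, and \<open>S\<close> gains its draws plus one for each lift, that is, for each rise of
  \<open>low\<close>. The equations are arranged without subtraction because the quantities are
  natural numbers.\<close>

lemma growth:
  assumes V: "finite V" "2 \<le> card V" and es: "set es \<subseteq> V" and T: "T \<le> length es" and S: "S \<subseteq> V"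
    and st: "s \<le> T"
    and pos: "\<And>t i. s < t \<Longrightarrow> t \<le> T \<Longrightarrow> i \<in> V - S \<Longrightarrow> excess V es t i \<noteq> 0"
  shows "(\<Sum>j\<in>S. state V es T j) + (\<Sum>j\<in>S. draw_count es s j) + low V (state V es s)
       = (\<Sum>j\<in>S. state V es s j) + (\<Sum>j\<in>S. draw_count es T j) + low V (state V es T)"
    and "i \<in> V - S \<Longrightarrow> state V es T i + draw_count es s i = state V es s i + draw_count es T i"
proof -
  have "(\<Sum>j\<in>S. state V es T j) + (\<Sum>j\<in>S. draw_count es s j) + low V (state V es s)
       = (\<Sum>j\<in>S. state V es s j) + (\<Sum>j\<in>S. draw_count es T j) + low V (state V es T) \<and>
     (\<forall>i\<in>V - S. state V es T i + draw_count es s i = state V es s i + draw_count es T i)"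
    using st T pos
  proof (induction T rule: dec_induct)
    case base
    show ?case by simp
  next
    case (step T)
    define y where "y = state V es T"
    define e where "e = es ! T"
    have e: "e \<in> V" using step.prems es by (auto simp: e_def subset_iff)
    have finS: "finite S" using S V finite_subset by blast
    have y': "state V es (Suc T) = climb V e y" using step.prems by (simp add: state_Suc y_def e_def)
    have dc: "draw_count es (Suc T) i = draw_count es T i + (if i = e then 1 else 0)" for i
      using step.prems by (auto simp: draw_count_Suc e_def)
    have dcS: "(\<Sum>j\<in>S. draw_count es (Suc T) j) = (\<Sum>j\<in>S. draw_count es T j) + (if e \<in> S then 1 else 0)"
      by (simp add: dc sum.distrib finS)
    have IH: "(\<Sum>j\<in>S. y j) + (\<Sum>j\<in>S. draw_count es s j) + low V (state V es s)
       = (\<Sum>j\<in>S. state V es s j) + (\<Sum>j\<in>S. draw_count es T j) + low V y"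
     "\<forall>i\<in>V - S. y i + draw_count es s i = state V es s i + draw_count es T i"
      using step unfolding y_def by auto
    have "tied V y" unfolding y_def by (rule tied_state) (use V es step in auto)
    with V(1) show ?case using e
    proof (cases rule: climb_cases)
      case free
      have "climb V e y i = y i + (if i = e then 1 else 0)" for i using free(1) by simp
      then have a: "state V es (Suc T) i = y i + (if i = e then 1 else 0)" for i by (simp add: y')
      have "(\<Sum>j\<in>S. state V es (Suc T) j) = (\<Sum>j\<in>S. y j) + (if e \<in> S then 1 else 0)"
        by (simp add: a sum.distrib finS)
      moreover have "low V (state V es (Suc T)) = low V y" using free(2) y' by simp
      ultimately show ?thesis using IH(1) dcS IH(2) by (intro conjI; (linarith | simp add: a dc))
    next
      case (lift j)
      have a: "state V es (Suc T) i = y i + (if i = e then 1 else 0) + (if i = j then 1 else 0)" for i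
        using lift(2,6) by (simp add: y')
      \<comment> \<open>The lifted edge has excess 0 after the step; if it were outside
        \<open>S\<close>, this would contradict the hypothesis at time \<open>Suc T\<close>.\<close>
      have zero: "excess V es (Suc T) j = 0" using a[of j] lift unfolding excess_def y' by simp
      have jS: "j \<in> S"
      proof (rule ccontr)
        assume "j \<notin> S"
        then show False using zero step.prems(2)[of "Suc T" j] step.hyps lift(1) by auto
      qed
      have "(\<Sum>j\<in>S. state V es (Suc T) j) = (\<Sum>j\<in>S. y j) + (if e \<in> S then 1 else 0) + 1"
        using jS by (simp add: a sum.distrib finS)
      moreover have "low V (state V es (Suc T)) = low V y + 1" using lift(7) y' by simp
      ultimately show ?thesis using IH(1) dcS IH(2) jS by (intro conjI; (linarith | auto simp: a dc))
    qed
  qed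
  then show "(\<Sum>j\<in>S. state V es T j) + (\<Sum>j\<in>S. draw_count es s j) + low V (state V es s)
       = (\<Sum>j\<in>S. state V es s j) + (\<Sum>j\<in>S. draw_count es T j) + low V (state V es T)"
    and "i \<in> V - S \<Longrightarrow> state V es T i + draw_count es s i = state V es s i + draw_count es T i"
    by auto
qed

lemma sum_draw_count:
  assumes "finite V" "set es \<subseteq> V" "t \<le> length es"
  shows "(\<Sum>i\<in>V. draw_count es t i) = t"
  using assms(3)
proof (induction t)
  case (Suc t)
  then have "es ! t \<in> V" using assms by (auto simp: subset_iff)
  with Suc assms show ?case by (simp add: draw_count_Suc sum.distrib)
qed (simp add: draw_count_0)

text \<open>Apply \<open>growth\<close> with \<open>S = V\<close> from time 0: the heights add up to
  \<open>T\<close> plus the lowest level. Taking that level off each of the \<open>card V\<close>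
  heights leaves the factor \<open>card V - 1\<close>.\<close>

lemma sum_excess:
  assumes V: "finite V" "2 \<le> card V" and es: "set es \<subseteq> V" and T: "T \<le> length es"
  shows "(\<Sum>j\<in>V. excess V es T j) + (card V - 1) * low V (state V es T) = T"
proof -
  have "low V (state V es 0) = 0"
    by (simp add: state_0 low_const_0 V)
  then have *: "(\<Sum>j\<in>V. state V es T j) = T + low V (state V es T)"
    using growth(1)[OF V es T, of V 0] sum_draw_count[OF V(1) es T]
    by (simp add: draw_count_0 state_0)
  have "(\<Sum>j\<in>V. state V es T j) = (\<Sum>j\<in>V. excess V es T j) + card V * low V (state V es T)"
    by (simp add: state_eq_excess[OF V(1)] sum.distrib)
  moreover have "card V * low V (state V es T) = (card V - 1) * low V (state V es T) + low V (state V es T)"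
    using V(2) by (cases "card V") auto
  ultimately show ?thesis using * by linarith
qed

text \<open>Look back to the last time \<open>s\<close> at which some \<open>i\<close> outside \<open>S\<close> was lowest. Since then all lifts
  went to \<open>S\<close>, which forces the lowest level to rise at least at rate
  \<open>card S / (card S - 1)\<close> times the rate at which \<open>i\<close> is drawn, up to the excess inside \<open>S\<close>.\<close>

lemma excess_adjoin:
  fixes D :: real
  assumes V: "finite V" "2 \<le> card V" and es: "set es \<subseteq> V" and T: "T \<le> length es"
    and S: "S \<subset> V" "2 \<le> card S"
    and dev: "\<And>i s. i \<in> V \<Longrightarrow> s \<le> T \<Longrightarrow>
      \<bar>real (draw_count es T i) - real (draw_count es s i) - (real T - real s) / real (card V)\<bar> \<le> D"
  shows "\<exists>i\<in>V - S. real (excess V es T i) \<le> (\<Sum>j\<in>S. real (excess V es T j)) + 3 * D"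
proof -
  \<comment> \<open>\<open>P\<close> holds at time 0, where all heights vanish, and at no time after
    \<open>T\<close>, so a last time \<open>s\<close> exists. After \<open>s\<close> no edge outside
    \<open>S\<close> has excess 0, as \<open>growth\<close> requires.\<close>
  define P where "P t \<longleftrightarrow> t \<le> T \<and> (\<exists>i\<in>V - S. excess V es t i = 0)" for t
  obtain i0 where "i0 \<in> V - S" using S by blast
  then have "P 0" by (auto simp: P_def excess_def state_0)
  define s where "s = (GREATEST t. P t)"
  have "P s" unfolding s_def by (rule GreatestI_nat[of P 0 T, OF \<open>P 0\<close>]) (simp add: P_def)
  then obtain i where s: "s \<le> T" and i: "i \<in> V - S" "excess V es s i = 0" by (auto simp: P_def)
  have max: "t \<le> s" if "P t" for t
    unfolding s_def by (rule Greatest_le_nat[of P t T, OF that]) (simp add: P_def)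
  have pos: "excess V es t k \<noteq> 0" if "s < t" "t \<le> T" "k \<in> V - S" for t k
    using max[of t] that by (fastforce simp: P_def)
  have SV: "S \<subseteq> V" using S by blast
  note g = growth[OF V es T SV s pos]
  define a where "a = real (low V (state V es s))"
  define b where "b = real (low V (state V es T))"
  define k where "k = real (card S)"
  define Z where "Z = (\<Sum>j\<in>S. real (excess V es T j))"
  define q where "q = (real T - real s) / real (card V)"
  have k: "2 \<le> k" using S by (simp add: k_def)
  have D0: "0 \<le> D" using dev[of i s] i s by force
  have "(\<Sum>j\<in>S. real (state V es T j)) = Z + k * b"
    using SV by (simp add: state_eq_excess[OF V(1)] subset_iff sum.distrib Z_def k_def b_def)
  moreover have "(\<Sum>j\<in>S. real (state V es s j)) \<ge> k * a"
  proof -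
    have "(\<Sum>j\<in>S. a) \<le> (\<Sum>j\<in>S. real (state V es s j))"
      by (rule sum_mono) (use SV low_le[OF V(1)] in \<open>auto simp: a_def\<close>)
    then show ?thesis by (simp add: k_def)
  qed
  moreover have "(\<Sum>j\<in>S. real (state V es T j)) + (\<Sum>j\<in>S. real (draw_count es s j)) + a
       = (\<Sum>j\<in>S. real (state V es s j)) + (\<Sum>j\<in>S. real (draw_count es T j)) + b"
    using arg_cong[OF g(1), of real] by (simp add: a_def b_def)
  moreover have "(\<Sum>j\<in>S. real (draw_count es T j)) - (\<Sum>j\<in>S. real (draw_count es s j)) \<ge> k * (q - D)"
  proof -
    have "(\<Sum>j\<in>S. q - D) \<le> (\<Sum>j\<in>S. real (draw_count es T j) - real (draw_count es s j))"
    proof (rule sum_mono)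
      fix j assume "j \<in> S"
      then show "q - D \<le> real (draw_count es T j) - real (draw_count es s j)"
        using dev[of j s] SV s by (auto simp: q_def)
    qed
    then show ?thesis by (simp add: k_def sum_subtractf)
  qed
  \<comment> \<open>The heights in \<open>S\<close> add up to at least \<open>k * a\<close> at time
    \<open>s\<close>, gain at least \<open>k * (q - D)\<close> by draws and \<open>b - a\<close> by
    lifts, and add up to \<open>Z + k * b\<close> at time \<open>T\<close>.\<close>
  ultimately have 1: "k * (q - D) \<le> Z + (k - 1) * (b - a)"
    by (simp add: algebra_simps)
  have "real (excess V es T i) + b = a + (real (draw_count es T i) - real (draw_count es s i))"
    using arg_cong[OF g(2)[OF _ _ _ i(1)], of real] i
    by (simp add: state_eq_excess[OF V(1)] a_def b_def)
  moreover have "real (draw_count es T i) - real (draw_count es s i) \<le> q + D"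
    using dev[of i s] i s by (auto simp: q_def)
  \<comment> \<open>Edge \<open>i\<close> was lowest at time \<open>s\<close> and has since risen by
    its draws only, while the lowest level has risen by \<open>b - a\<close>.\<close>
  ultimately have 2: "real (excess V es T i) \<le> q + D - (b - a)" by linarith
  have q0: "0 \<le> q" using s by (simp add: q_def)
  have Z0: "0 \<le> Z" unfolding Z_def by (rule sum_nonneg) simp
  have "real (excess V es T i) \<le> Z + 3 * D"
  proof (cases "q + D - (b - a) \<le> 0")
    case True
    then show ?thesis using 2 Z0 D0 by linarith
  next
    case False
    have "(k - 1) * (q + D - (b - a)) \<le> Z + (2 * k - 1) * D - q"
      using 1 by (simp add: algebra_simps)
    also have "\<dots> \<le> Z + (k - 1) * (3 * D)"
    proof -
      \<comment> \<open>The constant 3 comes from here: \<open>2 * k - 1\<close> is at most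
        \<open>3 * (k - 1)\<close> once \<open>k\<close> is at least 2.\<close>
      have "(2 * k - 1) * D \<le> (k - 1) * (3 * D)"
        using mult_right_mono[OF k D0] by (simp add: algebra_simps)
      then show ?thesis using q0 by linarith
    qed
    also have "\<dots> \<le> (k - 1) * (Z + 3 * D)"
      using mult_right_mono[of 1 "k - 1" Z] k Z0 by (simp add: algebra_simps)
    finally show ?thesis using 2 k by (simp add: mult_le_cancel_left)
  qed
  then show ?thesis using i unfolding Z_def by blast
qed

text \<open>Start with two lowest edges, whose excess is 0, and adjoin one edge at a time by
  \<open>excess_adjoin\<close>. Each adjunction at most doubles the sum and adds
  \<open>3 * D\<close>, a recursion that \<open>3 * D * (2 ^ k - 1)\<close> satisfies.\<close>

lemma sum_excess_le:
  fixes D :: real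
  assumes V: "finite V" "2 \<le> card V" and es: "set es \<subseteq> V" and T: "T \<le> length es"
    and dev: "\<And>i s. i \<in> V \<Longrightarrow> s \<le> T \<Longrightarrow>
      \<bar>real (draw_count es T i) - real (draw_count es s i) - (real T - real s) / real (card V)\<bar> \<le> D"
  shows "(\<Sum>j\<in>V. real (excess V es T j)) \<le> 3 * D * (2 ^ card V - 1)"
proof -
  have "V \<noteq> {}" using V by auto
  then have D0: "0 \<le> D" using dev[of _ T] by fastforce
  have "\<exists>S\<subseteq>V. card S = k \<and> (\<Sum>j\<in>S. real (excess V es T j)) \<le> 3 * D * (2 ^ k - 1)"
    if "2 \<le> k" "k \<le> card V" for k
    using that
  proof (induction k rule: dec_induct)
    case base
    have "2 \<le> card {j \<in> V. state V es T j = low V (state V es T)}"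
      using tied_state[OF V es T] by (simp add: tied_def)
    then obtain S where S: "S \<subseteq> {j \<in> V. state V es T j = low V (state V es T)}" "card S = 2"
      by (meson obtain_subset_with_card_n)
    have "(\<Sum>j\<in>S. real (excess V es T j)) = 0"
      by (rule sum.neutral) (use S in \<open>auto simp: excess_def\<close>)
    then show ?case using S D0 by (intro exI[of _ S]) auto
  next
    case (step k)
    then obtain S where S: "S \<subseteq> V" "card S = k"
      "(\<Sum>j\<in>S. real (excess V es T j)) \<le> 3 * D * (2 ^ k - 1)" by auto
    have fin: "finite S" using S V finite_subset by blast
    have "S \<subset> V" using S step by auto
    from excess_adjoin[OF V es T this _ dev] obtain i where i: "i \<in> V - S"
      "real (excess V es T i) \<le> (\<Sum>j\<in>S. real (excess V es T j)) + 3 * D"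
      using S step by auto
    have "(\<Sum>j\<in>insert i S. real (excess V es T j)) \<le> 2 * (3 * D * (2 ^ k - 1)) + 3 * D"
      using i S fin by simp
    also have "\<dots> = 3 * D * (2 ^ Suc k - 1)" by (simp add: algebra_simps)
    finally show ?case using i S fin by (intro exI[of _ "insert i S"]) auto
  qed
  from this[of "card V"] V show ?thesis by (metis card_subset_eq order_refl)
qed

subsection \<open>Concentration of the draw counts\<close>

lemma map_take_replicate_pmf:
  "s \<le> T \<Longrightarrow> map_pmf (take s) (replicate_pmf T p) = replicate_pmf s p"
proof (induction T arbitrary: s)
  case (Suc T)
  show ?case
  proof (cases s)
    case 0
    then show ?thesis by (simp add: map_pmf_const)
  next
    case (Suc r)
    then have IH: "map_pmf (take r) (replicate_pmf T p) = replicate_pmf r p"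
      using Suc.IH Suc.prems by simp
    then show ?thesis
      unfolding Suc replicate_pmf.simps
      by (simp add: map_bind_pmf bind_map_pmf flip: IH)
  qed
qed simp

lemma map_eq_pmf: "map_pmf (\<lambda>x. x = i) p = bernoulli_pmf (pmf p i)"
proof (rule pmf_eqI)
  fix b :: bool
  have *: "(\<lambda>x. x = i) -` {True} = {i}" "(\<lambda>x. x = i) -` {False} = UNIV - {i}" by auto
  show "pmf (map_pmf (\<lambda>x. x = i) p) b = pmf (bernoulli_pmf (pmf p i)) b"
    by (cases b) (simp_all add: pmf_map * measure_pmf_single pmf_le_1
        measure_pmf.prob_compl[of _ p, simplified])
qed

lemma map_count_replicate_pmf:
  "map_pmf (\<lambda>xs. count_list xs i) (replicate_pmf s p) = binomial_pmf s (pmf p i)"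
proof (induction s)
  case (Suc s)
  have "binomial_pmf (Suc s) (pmf p i) =
     do {b \<leftarrow> map_pmf (\<lambda>x. x = i) p; k \<leftarrow> map_pmf (\<lambda>xs. count_list xs i) (replicate_pmf s p);
         return_pmf ((if b then 1 else 0) + k)}"
    unfolding map_eq_pmf Suc by (rule binomial_pmf_Suc) (simp add: pmf_le_1)
  also have "\<dots> = map_pmf (\<lambda>xs. count_list xs i) (replicate_pmf (Suc s) p)"
    unfolding replicate_pmf.simps
    by (simp add: map_bind_pmf bind_map_pmf)
       (intro bind_pmf_cong refl, auto)
  finally show ?case ..
qed (simp add: binomial_pmf_0 pmf_le_1)

text \<open>The first \<open>s\<close> of \<open>T\<close> independent draws are again independent
  draws, so the count is binomial and Hoeffding's inequality applies.\<close>

lemma prob_prefix_count: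
  assumes "0 < s" "s \<le> T" "0 \<le> \<epsilon>"
  shows "measure_pmf.prob (replicate_pmf T p)
      {es. \<bar>real (draw_count es s i) - real s * pmf p i\<bar> \<ge> \<epsilon>} \<le> 2 * exp (-2 * \<epsilon>\<^sup>2 / real s)"
proof -
  have bin: "map_pmf (\<lambda>es. draw_count es s i) (replicate_pmf T p) = binomial_pmf s (pmf p i)"
    unfolding map_count_replicate_pmf[symmetric] map_take_replicate_pmf[OF assms(2), symmetric]
    by (simp add: pmf.map_comp o_def draw_count_def)
  have "measure_pmf.prob (replicate_pmf T p)
      {es. \<bar>real (draw_count es s i) - real s * pmf p i\<bar> \<ge> \<epsilon>} =
    measure_pmf.prob (binomial_pmf s (pmf p i)) {x. \<bar>real x - real s * pmf p i\<bar> \<ge> \<epsilon>}"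
    by (simp flip: bin)
  also have "\<dots> \<le> 2 * exp (-2 * \<epsilon>\<^sup>2 / real s)"
    by (rule binomial_distribution.prob_abs_ge) (use assms in \<open>auto simp: binomial_distribution_def pmf_le_1\<close>)
  finally show ?thesis .
qed

text \<open>All times up to \<open>T\<close> are included, not only the last, because the look-back
  time in \<open>excess_adjoin\<close> depends on the sequence of draws.\<close>

definition unsteady :: "'e set \<Rightarrow> nat \<Rightarrow> real \<Rightarrow> 'e list set" where
  "unsteady V T \<epsilon> = {es. \<exists>i\<in>V. \<exists>s\<le>T. \<bar>real (draw_count es s i) - real s / real (card V)\<bar> > \<epsilon>}"

text \<open>A union bound over all edges and all times from 1 to \<open>T\<close>, with the
  Hoeffding exponent weakened from \<open>s\<close> to \<open>T\<close> so that all terms are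
  equal.\<close>

lemma prob_unsteady:
  assumes V: "finite V" "V \<noteq> {}" and \<epsilon>: "0 \<le> \<epsilon>"
  shows "measure_pmf.prob (replicate_pmf T (pmf_of_set V)) (unsteady V T \<epsilon>)
    \<le> real (card V) * real T * (2 * exp (-2 * \<epsilon>\<^sup>2 / real T))"
proof -
  define p where "p = replicate_pmf T (pmf_of_set V)"
  define B where "B s i = {es. \<bar>real (draw_count es s i) - real s * pmf (pmf_of_set V) i\<bar> \<ge> \<epsilon>}" for s i
  have "unsteady V T \<epsilon> \<subseteq> (\<Union>(i, s)\<in>V \<times> {1..T}. B s i)"
  proof
    fix es assume "es \<in> unsteady V T \<epsilon>"
    then obtain i s where i: "i \<in> V" "s \<le> T"
      "\<bar>real (draw_count es s i) - real s / real (card V)\<bar> > \<epsilon>" by (auto simp: unsteady_def)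
    \<comment> \<open>At time 0 the deviation is 0, which is not larger than
      \<open>\<epsilon>\<close>.\<close>
    have "s \<noteq> 0" using i \<epsilon> by (auto simp: draw_count_def intro: ccontr)
    then show "es \<in> (\<Union>(i, s)\<in>V \<times> {1..T}. B s i)"
      using i V by (auto simp: B_def intro!: bexI[of _ i] bexI[of _ s])
  qed
  then have "measure_pmf.prob p (unsteady V T \<epsilon>) \<le> measure_pmf.prob p (\<Union>(i, s)\<in>V \<times> {1..T}. B s i)"
    by (rule measure_pmf.finite_measure_mono) simp
  also have "\<dots> \<le> (\<Sum>(i, s)\<in>V \<times> {1..T}. measure_pmf.prob p (B s i))"
    using measure_pmf.finite_measure_subadditive_finite[of "V \<times> {1..T}" "\<lambda>(i, s). B s i" p] V
    by (simp add: case_prod_unfold)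
  also have "\<dots> \<le> (\<Sum>(i, s)\<in>V \<times> {1..T}. 2 * exp (-2 * \<epsilon>\<^sup>2 / real T))"
  proof (rule sum_mono, clarify)
    fix i s assume s: "s \<in> {1..T}"
    then have "measure_pmf.prob p (B s i) \<le> 2 * exp (-2 * \<epsilon>\<^sup>2 / real s)"
      unfolding p_def B_def using \<epsilon> by (intro prob_prefix_count) auto
    also have "\<dots> \<le> 2 * exp (-2 * \<epsilon>\<^sup>2 / real T)"
      using s by (auto intro!: divide_left_mono)
    finally show "measure_pmf.prob p (B s i) \<le> 2 * exp (-2 * \<epsilon>\<^sup>2 / real T)" .
  qed
  also have "\<dots> = real (card V) * real T * (2 * exp (-2 * \<epsilon>\<^sup>2 / real T))"
    by (simp add: card_cartesian_product)
  finally show ?thesis unfolding p_def .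
qed

section \<open>Comparison of the balanced model with the uniform model\<close>

lemma pmf_replicate_pmf_Cons:
  "pmf (replicate_pmf (Suc n) p) (x # xs) = pmf p x * pmf (replicate_pmf n p) xs"
proof -
  have "replicate_pmf (Suc n) p = map_pmf (\<lambda>(x, xs). x # xs) (pair_pmf p (replicate_pmf n p))"
    by (simp add: pair_pmf_def map_bind_pmf)
  also have "pmf \<dots> (x # xs) = pmf (pair_pmf p (replicate_pmf n p)) (x, xs)"
    using pmf_map_inj'[of "\<lambda>(x, xs). x # xs" _ "(x, xs)"] by (force simp: inj_def)
  finally show ?thesis by (simp add: pmf_pair)
qed

lemma pmf_replicate_pmf_of_set:
  assumes V: "finite V" "V \<noteq> {}"
  shows "set xs \<subseteq> V \<Longrightarrow> pmf (replicate_pmf (length xs) (pmf_of_set V)) xs = 1 / real (card V) ^ length xs"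
proof (induction xs)
  case (Cons x xs)
  then show ?case using V by (simp add: pmf_replicate_pmf_Cons del: replicate_pmf.simps)
qed simp

text \<open>Passing from \<open>k\<close> to \<open>k + 1\<close> multiplies
  \<open>N ^ k / fact k\<close> by \<open>N / (k + 1)\<close>, so this quotient is largest at
  \<open>k = N\<close>. The two inductions move away from \<open>N\<close> in both
  directions.\<close>

lemma fact_mult_power_le: "fact N * N ^ k \<le> (fact k * N ^ N :: nat)"
proof (cases "N \<le> k")
  case True
  then show ?thesis
  proof (induction k rule: dec_induct)
    case (step j)
    have "fact N * N ^ Suc j = N * (fact N * N ^ j)" by simp
    also have "\<dots> \<le> Suc j * (fact j * N ^ N)" 
      by (rule mult_le_mono[OF _ step.IH]) (use step.hyps in simp)
    finally show ?case by (simp add: algebra_simps)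
  qed simp
next
  case False
  then have "k \<le> N" by simp
  then show ?thesis
  proof (induction k rule: inc_induct)
    case (step j)
    have "N * (fact N * N ^ j) \<le> Suc j * (fact j * N ^ N)" using step.IH by (simp add: algebra_simps)
    also have "\<dots> \<le> N * (fact j * N ^ N)" using step by (intro mult_right_mono) auto
    finally show ?case using step.hyps by simp
  qed simp
qed

text \<open>Multiply \<open>fact_mult_power_le\<close> over all \<open>i\<close>. Since the
  \<open>k i\<close> add up to \<open>N * card V\<close>, the powers of \<open>N\<close> on both
  sides agree and cancel.\<close>

lemma prod_fact_ge:
  fixes k :: "'a \<Rightarrow> nat"
  assumes N: "0 < N" and k: "(\<Sum>i\<in>V. k i) = N * card V"
  shows "fact N ^ card V \<le> (\<Prod>i\<in>V. fact (k i) :: nat)"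
proof -
  have "(\<Prod>i\<in>V. fact N * N ^ k i) \<le> (\<Prod>i\<in>V. fact (k i) * N ^ N)"
    by (intro prod_mono) (simp add: fact_mult_power_le)
  then have "fact N ^ card V * N ^ (N * card V) \<le> (\<Prod>i\<in>V. fact (k i)) * N ^ (N * card V)"
    by (simp add: prod.distrib power_sum[symmetric] k power_mult)
  then show ?thesis using N by simp
qed

definition balanced_mset :: "'e set \<Rightarrow> nat \<Rightarrow> 'e multiset" where
  "balanced_mset V N = (\<Sum>e\<in>V. replicate_mset N e)"

lemma count_balanced_mset: "finite V \<Longrightarrow> count (balanced_mset V N) x = (if x \<in> V then N else 0)"
  by (simp add: balanced_mset_def count_sum)

lemma size_balanced_mset: "size (balanced_mset V N) = N * card V"
  by (simp add: balanced_mset_def size_multiset_sum)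

lemma set_balanced_mset: "finite V \<Longrightarrow> set_mset (balanced_mset V N) \<subseteq> V"
  by (auto simp: count_balanced_mset simp flip: count_greater_zero_iff split: if_splits)

lemma permutations_of_balanced_msetD:
  assumes "finite V" "xs \<in> permutations_of_multiset (balanced_mset V N)"
  shows "set xs \<subseteq> V" "length xs = N * card V"
proof -
  have m: "mset xs = balanced_mset V N" using assms(2) by (rule permutations_of_multisetD)
  show "set xs \<subseteq> V" using set_balanced_mset[OF assms(1), of N] by (simp flip: m)
  show "length xs = N * card V" using size_balanced_mset[of V N] by (simp flip: m)
qed

text \<open>The multinomial formula with the product taken over a common index set \<open>V\<close>,
  so that multisets with different supports can be compared; absent elements contribute
  \<open>fact 0 = 1\<close>.\<close>

lemma card_permutations_of_multiset_superset:
  assumes "finite V" "set_mset X \<subseteq> V"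
  shows "card (permutations_of_multiset X) * (\<Prod>x\<in>V. fact (count X x)) = fact (size X)"
proof -
  have "(\<Prod>x\<in>V. fact (count X x)) = (\<Prod>x\<in>set_mset X. fact (count X x) :: nat)"
    by (rule prod.mono_neutral_right) (use assms in \<open>auto simp: not_in_iff\<close>)
  then show ?thesis by (simp add: card_permutations_of_multiset_aux)
qed

text \<open>Among multinomial coefficients of the same total, the one with equal parts is largest,
  since its denominator is smallest by \<open>prod_fact_ge\<close>.\<close>

lemma card_permutations_le_balanced:
  assumes V: "finite V" and N: "0 < N" and X: "set_mset X \<subseteq> V" "size X = N * card V"
  shows "card (permutations_of_multiset X) \<le> card (permutations_of_multiset (balanced_mset V N))"
proof -
  have sum: "(\<Sum>i\<in>V. count X i) = N * card V"
  proof -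
    have "(\<Sum>i\<in>V. count X i) = (\<Sum>i\<in>set_mset X. count X i)"
      by (rule sum.mono_neutral_right) (use V X in \<open>auto simp: not_in_iff\<close>)
    then show ?thesis using X by (simp add: size_multiset_overloaded_eq)
  qed
  have "card (permutations_of_multiset X) * (\<Prod>x\<in>V. fact (count X x)) =
      card (permutations_of_multiset (balanced_mset V N)) * fact N ^ card V"
    using card_permutations_of_multiset_superset[OF V X(1)] X(2)
      card_permutations_of_multiset_superset[OF V set_balanced_mset[OF V], of N]
    by (simp add: count_balanced_mset V size_balanced_mset)
  also have "\<dots> \<le> card (permutations_of_multiset (balanced_mset V N)) * (\<Prod>x\<in>V. fact (count X x))"
    by (intro mult_left_mono prod_fact_ge N sum) simp
  finally show ?thesis by (simp add: prod_pos)
qed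

text \<open>Sort the words of length \<open>T\<close> by their multisets of letters. There are at
  most \<open>(T + 1) ^ card V\<close> classes, and none is larger than the balanced one.\<close>

lemma card_lists_le_balanced:
  assumes V: "finite V" and N: "0 < N"
  defines "T \<equiv> N * card V"
  shows "card V ^ T \<le> (T + 1) ^ card V * card (permutations_of_multiset (balanced_mset V N))"
proof -
  define L where "L = {xs. set xs \<subseteq> V \<and> length xs = T}"
  define Q where "Q = mset ` L"
  have finL: "finite L" unfolding L_def by (rule finite_lists_length_eq[OF V])
  have Q: "set_mset X \<subseteq> V" "size X = T" if "X \<in> Q" for X using that by (auto simp: Q_def L_def)
  \<comment> \<open>A multiset in \<open>Q\<close> is determined by its counts on \<open>V\<close>,
    each of which is at most \<open>T\<close>.\<close>
  have "card Q \<le> card (V \<rightarrow>\<^sub>E {..T})"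
  proof (rule card_inj_on_le[of "\<lambda>X. restrict (count X) V"])
    show "inj_on (\<lambda>X. restrict (count X) V) Q"
    proof (rule inj_onI, rule multiset_eqI)
      fix X Y x assume XY: "X \<in> Q" "Y \<in> Q" "restrict (count X) V = restrict (count Y) V"
      show "count X x = count Y x"
      proof (cases "x \<in> V")
        case True
        then show ?thesis using fun_cong[OF XY(3), of x] by simp
      next
        case False
        then have "x \<notin># X" "x \<notin># Y" using Q XY by auto
        then show ?thesis by (simp add: not_in_iff)
      qed
    qed
    show "(\<lambda>X. restrict (count X) V) ` Q \<subseteq> V \<rightarrow>\<^sub>E {..T}"
      using Q count_le_size by fastforce
  qed (simp add: V finite_PiE)
  also have "\<dots> = (T + 1) ^ card V" using V by (simp add: card_PiE)
  finally have cQ: "card Q \<le> (T + 1) ^ card V" .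
  have "L \<subseteq> (\<Union>X\<in>Q. permutations_of_multiset X)"
    by (auto simp: Q_def permutations_of_multiset_def)
  then have "card L \<le> card (\<Union>X\<in>Q. permutations_of_multiset X)"
    using finL by (intro card_mono) (auto simp: Q_def)
  also have "\<dots> \<le> (\<Sum>X\<in>Q. card (permutations_of_multiset X))"
    by (rule card_UN_le) (simp add: Q_def finL)
  also have "\<dots> \<le> (\<Sum>X\<in>Q. card (permutations_of_multiset (balanced_mset V N)))"
    by (rule sum_mono, rule card_permutations_le_balanced[OF V N]) (use Q in \<open>auto simp: T_def\<close>)
  also have "\<dots> \<le> (T + 1) ^ card V * card (permutations_of_multiset (balanced_mset V N))"
    using cQ by simp
  finally show ?thesis by (simp add: L_def card_lists_length_eq[OF V])
qed

text \<open>All balanced words have the same probability in the uniform model, so the balanced model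
  is the uniform one conditioned on the set \<open>A\<close> of balanced words. By
  \<open>card_lists_le_balanced\<close>, conditioning costs at most the factor
  \<open>(T + 1) ^ card V\<close>.\<close>

lemma prob_balanced_le:
  assumes V: "finite V" "V \<noteq> {}" and N: "0 < N"
  defines "T \<equiv> N * card V"
  shows "measure_pmf.prob (pmf_of_set (permutations_of_multiset (balanced_mset V N))) B
    \<le> (real T + 1) ^ card V * measure_pmf.prob (replicate_pmf T (pmf_of_set V)) B"
proof -
  define A where "A = permutations_of_multiset (balanced_mset V N)"
  have A: "finite A" "A \<noteq> {}" by (simp_all add: A_def)
  then have cA: "0 < real (card A)" by (simp add: card_gt_0_iff)
  have pA: "pmf (replicate_pmf T (pmf_of_set V)) xs = 1 / real (card V) ^ T" if "xs \<in> A" for xs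
    using permutations_of_balanced_msetD[OF V(1), of xs N] that pmf_replicate_pmf_of_set[OF V, of xs]
    by (simp add: A_def T_def)
  have "real (card (A \<inter> B)) / real (card V) ^ T
      = (\<Sum>xs\<in>A \<inter> B. pmf (replicate_pmf T (pmf_of_set V)) xs)"
    by (simp add: pA)
  also have "\<dots> = measure_pmf.prob (replicate_pmf T (pmf_of_set V)) (A \<inter> B)"
    using A by (simp add: measure_measure_pmf_finite)
  also have "\<dots> \<le> measure_pmf.prob (replicate_pmf T (pmf_of_set V)) B" (is "_ \<le> ?u")
    by (rule measure_pmf.finite_measure_mono) auto
  finally have 1: "real (card (A \<inter> B)) / real (card V) ^ T \<le> ?u" .
  have cV: "0 < real (card V) ^ T" using V by (simp add: card_gt_0_iff)
  have "real (card (A \<inter> B)) \<le> real (card V) ^ T * ?u"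
    using 1 cV by (simp add: field_simps)
  also have "\<dots> \<le> ((real T + 1) ^ card V * real (card A)) * ?u"
  proof (rule mult_right_mono)
    have "real (card V ^ T) \<le> real ((T + 1) ^ card V * card A)"
      using card_lists_le_balanced[OF V(1) N] unfolding T_def A_def of_nat_le_iff .
    then show "real (card V) ^ T \<le> (real T + 1) ^ card V * real (card A)" by (simp add: add.commute)
  qed simp
  finally have "real (card (A \<inter> B)) / real (card A) \<le> (real T + 1) ^ card V * ?u"
    using cA by (simp add: field_simps)
  then show ?thesis using A unfolding A_def[symmetric] by (simp add: measure_pmf_of_set)
qed

section \<open>Vanishing of the deviation probabilities\<close>

lemma unsteady_bound_tendsto_0:
  fixes n :: nat and \<delta> :: real
  assumes "0 < n" "0 < \<delta>"
  shows "(\<lambda>N. (real (N * n) + 1) ^ n * (real n * real (N * n) * (2 * exp (- 2 * (\<delta> * real N)\<^sup>2 / real (N * n)))))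
    \<longlonglongrightarrow> 0"
proof -
  have "0 < real n" using assms by simp
  \<comment> \<open>The exponent is a negative multiple of \<open>N\<close>, so the exponential
    beats the polynomial factors. The power is written with \<open>powr\<close> so that its symbolic
    exponent is a real parameter.\<close>
  with assms(2) have "(\<lambda>N. (real N * real n + 1) powr real n *
     (real n * (real N * real n) * (2 * exp (- 2 * (\<delta> * real N)\<^sup>2 / (real N * real n))))) \<longlonglongrightarrow> 0"
    by real_asymp
  moreover have "(real N * real n + 1) powr real n = (real N * real n + 1) ^ n" for N
    by (rule powr_realpow) (simp add: add_nonneg_pos)
  ultimately show ?thesis by simp
qed

lemma prob_unsteady_uniform_tendsto_0:
  fixes \<delta> :: real
  assumes V: "finite V" "V \<noteq> {}" and \<delta>: "0 < \<delta>"
  shows "(\<lambda>N. measure_pmf.prob (replicate_pmf (N * card V) (pmf_of_set V))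
    (unsteady V (N * card V) (\<delta> * real N))) \<longlonglongrightarrow> 0"
proof (rule Lim_null_comparison[OF _ unsteady_bound_tendsto_0[of "card V" \<delta>]])
  show "\<forall>\<^sub>F N in sequentially. norm (measure_pmf.prob (replicate_pmf (N * card V) (pmf_of_set V))
      (unsteady V (N * card V) (\<delta> * real N))) \<le>
    (real (N * card V) + 1) ^ card V * (real (card V) * real (N * card V) *
      (2 * exp (- 2 * (\<delta> * real N)\<^sup>2 / real (N * card V))))"
  proof (rule always_eventually, rule allI)
    fix N :: nat
    let ?b = "real (card V) * real (N * card V) * (2 * exp (- 2 * (\<delta> * real N)\<^sup>2 / real (N * card V)))"
    have "measure_pmf.prob (replicate_pmf (N * card V) (pmf_of_set V))
      (unsteady V (N * card V) (\<delta> * real N)) \<le> ?b"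
      using prob_unsteady[OF V, of "\<delta> * real N" "N * card V"] \<delta> by simp
    \<comment> \<open>Inserting the polynomial factor, which is at least 1, lets the limit used for
      the balanced model serve here too.\<close>
    also have "\<dots> \<le> (real (N * card V) + 1) ^ card V * ?b"
      using mult_right_mono[of 1 "(real (N * card V) + 1) ^ card V" ?b] by (simp add: one_le_power)
    finally show "norm (measure_pmf.prob (replicate_pmf (N * card V) (pmf_of_set V))
      (unsteady V (N * card V) (\<delta> * real N))) \<le> (real (N * card V) + 1) ^ card V * ?b" by simp
  qed
qed (use V \<delta> in \<open>auto simp: card_gt_0_iff\<close>)

lemma prob_unsteady_balanced_tendsto_0:
  fixes \<delta> :: real
  assumes V: "finite V" "V \<noteq> {}" and \<delta>: "0 < \<delta>"
  shows "(\<lambda>N. measure_pmf.prob (pmf_of_set (permutations_of_multiset (balanced_mset V N)))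
    (unsteady V (N * card V) (\<delta> * real N))) \<longlonglongrightarrow> 0"
proof (rule Lim_null_comparison[OF _ unsteady_bound_tendsto_0[of "card V" \<delta>]])
  show "\<forall>\<^sub>F N in sequentially. norm (measure_pmf.prob
      (pmf_of_set (permutations_of_multiset (balanced_mset V N)))
      (unsteady V (N * card V) (\<delta> * real N))) \<le>
    (real (N * card V) + 1) ^ card V * (real (card V) * real (N * card V) *
      (2 * exp (- 2 * (\<delta> * real N)\<^sup>2 / real (N * card V))))"
    using eventually_gt_at_top[of 0]
  proof eventually_elim
    case (elim N)
    let ?b = "real (card V) * real (N * card V) * (2 * exp (- 2 * (\<delta> * real N)\<^sup>2 / real (N * card V)))"
    have "measure_pmf.prob (pmf_of_set (permutations_of_multiset (balanced_mset V N)))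
      (unsteady V (N * card V) (\<delta> * real N)) \<le> (real (N * card V) + 1) ^ card V *
        measure_pmf.prob (replicate_pmf (N * card V) (pmf_of_set V))
      (unsteady V (N * card V) (\<delta> * real N))"
      by (rule prob_balanced_le[OF V elim])
    also have "\<dots> \<le> (real (N * card V) + 1) ^ card V * ?b"
      using prob_unsteady[OF V, of "\<delta> * real N" "N * card V"] \<delta> by (intro mult_left_mono) auto
    finally show ?case by simp
  qed
qed (use V \<delta> in \<open>auto simp: card_gt_0_iff\<close>)

text \<open>It suffices to control the outcomes in the support that avoid a bad event of vanishing
  probability; the limit then follows by squeezing. The index 0 is left out because later estimates
  divide by \<open>N\<close>.\<close>

lemma whp_limitI:
  assumes B: "\<And>\<delta>::real. 0 < \<delta> \<Longrightarrow> (\<lambda>N. measure_pmf.prob (p N) (B \<delta> N)) \<longlonglongrightarrow> 0"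
    and close: "\<And>\<epsilon>::real. 0 < \<epsilon> \<Longrightarrow> \<exists>\<delta>>0. \<forall>N>0. \<forall>\<omega>\<in>set_pmf (p N) - B \<delta> N. \<bar>X N \<omega> - ereal c\<bar> \<le> ereal \<epsilon>"
  shows "whp_limit p X c"
  unfolding whp_limit_def
proof (intro allI impI)
  fix \<epsilon> :: real assume "0 < \<epsilon>"
  then obtain \<delta> where \<delta>: "0 < \<delta>"
    "\<And>N \<omega>. 0 < N \<Longrightarrow> \<omega> \<in> set_pmf (p N) - B \<delta> N \<Longrightarrow> \<bar>X N \<omega> - ereal c\<bar> \<le> ereal \<epsilon>"
    using close by meson
  have "(\<lambda>N. 1 - measure_pmf.prob (p N) (B \<delta> N)) \<longlonglongrightarrow> 1 - 0"
    by (intro tendsto_intros B \<delta>)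
  then have lim: "(\<lambda>N. 1 - measure_pmf.prob (p N) (B \<delta> N)) \<longlonglongrightarrow> 1" by simp
  show "(\<lambda>N. measure_pmf.prob (p N) {\<omega>. \<bar>X N \<omega> - ereal c\<bar> \<le> ereal \<epsilon>}) \<longlonglongrightarrow> 1"
  proof (rule tendsto_sandwich[OF _ _ lim tendsto_const])
    show "\<forall>\<^sub>F N in sequentially. 1 - measure_pmf.prob (p N) (B \<delta> N)
        \<le> measure_pmf.prob (p N) {\<omega>. \<bar>X N \<omega> - ereal c\<bar> \<le> ereal \<epsilon>}"
      using eventually_gt_at_top[of 0]
    proof eventually_elim
      case (elim N)
      have "1 - measure_pmf.prob (p N) (B \<delta> N) = measure_pmf.prob (p N) (- B \<delta> N)"
        using measure_pmf.prob_compl[of "B \<delta> N" "p N"] by (simp add: Compl_eq_Diff_UNIV)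
      also have "\<dots> = measure_pmf.prob (p N) (- B \<delta> N \<inter> set_pmf (p N))"
        by (simp add: measure_Int_set_pmf)
      also have "\<dots> \<le> measure_pmf.prob (p N) {\<omega>. \<bar>X N \<omega> - ereal c\<bar> \<le> ereal \<epsilon>}"
        by (rule measure_pmf.finite_measure_mono) (use \<delta>(2)[OF elim] in auto)
      finally show ?case .
    qed
  qed simp
qed

subsection \<open>Limits with high probability\<close>

text \<open>\<open>sum_excess\<close> gives \<open>(n - 1) * M = n * N - Z\<close> for the lowest
  level \<open>M\<close> and the total excess \<open>Z\<close>, and \<open>sum_excess_le\<close>
  with \<open>D = 2 * \<delta> * N\<close> bounds \<open>Z\<close>. A height differs from
  \<open>M\<close> by at most \<open>Z\<close>.\<close>

lemma state_near_mean:
  fixes \<delta> :: real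
  assumes V: "finite V" "2 \<le> card V" and es: "set es \<subseteq> V" "length es = N * card V" and N: "0 < N"
    and steady: "es \<notin> unsteady V (N * card V) (\<delta> * real N)"
    and i: "i \<in> V"
  shows "\<bar>real (state V es (N * card V) i) / real N - real (card V) / (real (card V) - 1)\<bar> \<le> 6 * 2 ^ card V * \<delta>"
    and "\<bar>real (draw_count es (N * card V) i) / real N - 1\<bar> \<le> 6 * 2 ^ card V * \<delta>"
proof -
  define T where "T = N * card V"
  define n where "n = real (card V)"
  define M where "M = real (low V (state V es T))"
  define Z where "Z = (\<Sum>j\<in>V. real (excess V es T j))"
  have n: "2 \<le> n" using V by (simp add: n_def)
  have T: "real T / n = real N" using n by (simp add: T_def n_def)
  have dc: "\<bar>real (draw_count es s j) - real s / n\<bar> \<le> \<delta> * real N" if "j \<in> V" "s \<le> T" for j s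
    using steady that by (force simp: unsteady_def n_def T_def)
  \<comment> \<open>The factor 2 arises because the draws between \<open>s\<close> and
    \<open>T\<close> are a difference of two prefix counts.\<close>
  have dev: "\<bar>real (draw_count es T j) - real (draw_count es s j) - (real T - real s) / n\<bar> \<le> 2 * \<delta> * real N"
    if "j \<in> V" "s \<le> T" for j s
    using dc[OF that] dc[OF that(1) order_refl] by (simp add: diff_divide_distrib abs_le_iff)
  have \<delta>: "0 \<le> \<delta> * real N" using dc[OF i order_refl] by linarith
  then have \<delta>0: "0 \<le> \<delta>" using N by (simp add: zero_le_mult_iff)
  have Z: "Z \<le> 3 * (2 * \<delta> * real N) * (2 ^ card V - 1)"
    unfolding Z_def using sum_excess_le[OF V es(1), of T "2 * \<delta> * real N"] dev es(2)
    by (auto simp: n_def T_def)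
  also have "\<dots> \<le> (6 * 2 ^ card V * \<delta>) * real N"
    using \<delta> by (simp add: algebra_simps)
  finally have Z: "Z \<le> (6 * 2 ^ card V * \<delta>) * real N" .
  have ex: "0 \<le> real (excess V es T i)" "real (excess V es T i) \<le> Z"
    unfolding Z_def using member_le_sum[of i V "\<lambda>j. real (excess V es T j)"] i V by auto
  have "real ((\<Sum>j\<in>V. excess V es T j) + (card V - 1) * low V (state V es T)) = real T"
    using sum_excess[OF V es(1), of T] es(2) by (simp add: T_def)
  then have total: "Z + (n - 1) * M = n * real N"
    using V by (simp add: Z_def M_def n_def T_def of_nat_diff)
  define a where "a = n / (n - 1)"
  have "M = (n * real N - Z) / (n - 1)"
    using total n by (simp add: nonzero_eq_divide_eq algebra_simps)
  then have "M = a * real N - Z / (n - 1)"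
    by (simp add: a_def diff_divide_distrib)
  moreover have "0 \<le> Z / (n - 1)" "Z / (n - 1) \<le> Z"
    using ex n mult_left_mono[of 1 "n - 1" Z] by (simp_all add: divide_le_eq)
  moreover have "real (state V es T i) = real (excess V es T i) + M"
    using state_eq_excess[OF V(1) i] by (simp add: M_def)
  \<comment> \<open>The difference is the excess of \<open>i\<close> minus
    \<open>Z / (n - 1)\<close>, and both numbers lie between 0 and \<open>Z\<close>.\<close>
  ultimately have "\<bar>real (state V es T i) - a * real N\<bar> \<le> Z"
    using ex by (simp add: abs_le_iff)
  then have "\<bar>real (state V es T i) - a * real N\<bar> \<le> (6 * 2 ^ card V * \<delta>) * real N" using Z by linarith
  moreover have "real (state V es T i) / real N - a = (real (state V es T i) - a * real N) / real N"
    using N by (simp add: field_simps)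
  ultimately show "\<bar>real (state V es (N * card V) i) / real N - real (card V) / (real (card V) - 1)\<bar>
      \<le> 6 * 2 ^ card V * \<delta>"
    using N by (simp add: T_def a_def n_def pos_divide_le_eq)
  have "\<bar>real (draw_count es T i) - real N\<bar> \<le> \<delta> * real N"
    using dc[OF i order_refl] T by simp
  moreover have "real (draw_count es T i) / real N - 1 = (real (draw_count es T i) - real N) / real N"
    using N by (simp add: field_simps)
  ultimately have "\<bar>real (draw_count es T i) / real N - 1\<bar> \<le> \<delta>"
    using N by (simp add: pos_divide_le_eq)
  also have "\<dots> \<le> 6 * 2 ^ card V * \<delta>"
  proof -
    have "(1::real) \<le> 2 ^ card V" by (rule one_le_power) simp
    then have "(1::real) \<le> 6 * 2 ^ card V" by linarith
    from mult_right_mono[OF this \<delta>0] show ?thesis by simp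
  qed
  finally show "\<bar>real (draw_count es (N * card V) i) / real N - 1\<bar> \<le> 6 * 2 ^ card V * \<delta>"
    by (simp add: T_def)
qed

text \<open>Write \<open>x - a * y\<close> as \<open>(x - a) - a * (y - 1)\<close>, which is at most
  \<open>3 * \<eta>\<close> in absolute value. Dividing by \<open>y\<close>, which is at least 1/2,
  at most doubles this.\<close>

lemma ratio_near:
  fixes x y a \<eta> :: real
  assumes "\<bar>x - a\<bar> \<le> \<eta>" "\<bar>y - 1\<bar> \<le> \<eta>" "\<eta> \<le> 1 / 2" "0 \<le> a" "a \<le> 2"
  shows "\<bar>x / y - a\<bar> \<le> 6 * \<eta>"
proof -
  have y: "1 / 2 \<le> y" using assms by (simp add: abs_le_iff)
  have "\<bar>x - a * y\<bar> = \<bar>(x - a) - a * (y - 1)\<bar>" by (simp add: algebra_simps)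
  also have "\<dots> \<le> \<bar>x - a\<bar> + \<bar>a * (y - 1)\<bar>" by (rule abs_triangle_ineq4)
  also have "\<dots> \<le> \<eta> + 2 * \<eta>"
    unfolding abs_mult using assms by (intro add_mono mult_mono) auto
  also have "\<dots> \<le> (6 * \<eta>) * y"
    using mult_left_mono[OF y, of "6 * \<eta>"] assms by simp
  finally have "\<bar>x - a * y\<bar> \<le> (6 * \<eta>) * y" .
  moreover have "x / y - a = (x - a * y) / y" using y by (simp add: field_simps)
  ultimately show ?thesis using y by (simp add: pos_divide_le_eq)
qed

text \<open>This treats both models at once: a model enters only through the support of its draw
  sequences and the vanishing probability of \<open>unsteady\<close>.\<close>

lemma CU_process_dual_complete_whp:
  fixes n :: nat and H :: "(nat set, nat) hypergraph"
  assumes n: "n \<ge> 2" and H: "H = dual (complete_graph_K n)"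
    and draws: "\<And>N es. es \<in> set_pmf (p N) \<Longrightarrow> set es \<subseteq> {1..n} \<and> length es = N * n"
    and steady: "\<And>\<delta>::real. 0 < \<delta> \<Longrightarrow>
      (\<lambda>N. measure_pmf.prob (p N) (unsteady {1..n} (N * n) (\<delta> * real N))) \<longlonglongrightarrow> 0"
  shows "v \<in> vertices H \<Longrightarrow> whp_limit p
      (\<lambda>N es. ereal (real (vertex_counter H es (num_steps H N) v) / real N)) (real n / (real n - 1))"
    and "e \<in> edges H \<Longrightarrow> whp_limit p (\<lambda>N es. relative_error H es (num_steps H N) e) (1 / (real n - 1))"
proof -
  have steps: "num_steps H N = N * n" for N
    by (simp add: num_steps_def H edges_dual_complete)
  define a where "a = real n / (real n - 1)"
  have a: "0 \<le> a" "a \<le> 2" "1 / (real n - 1) = a - 1" using n by (auto simp: a_def field_simps)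
  define \<eta> where "\<eta> \<delta> = 6 * 2 ^ n * (\<delta>::real)" for \<delta>
  have near: "\<bar>real (state {1..n} es (N * n) i) / real N - a\<bar> \<le> \<eta> \<delta>"
      "\<bar>real (draw_count es (N * n) i) / real N - 1\<bar> \<le> \<eta> \<delta>"
    if "0 < N" "es \<in> set_pmf (p N) - unsteady {1..n} (N * n) (\<delta> * real N)" "i \<in> {1..n}" for N es \<delta> i
    using state_near_mean[of "{1..n}" es N \<delta> i] draws[of es N] that n
    by (auto simp: a_def \<eta>_def)
  have rep: "represents {1..n} (vertex_counter H es (N * n)) (state {1..n} es (N * n))"
    if "es \<in> set_pmf (p N)" for N es
    unfolding H using draws[OF that] by (intro vertex_counter_state n) auto
  {
    assume "v \<in> vertices H"
    then obtain i j where ij: "v = {i, j}" "i \<in> {1..n}" "j \<in> {1..n}" "i \<noteq> j"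
      by (auto simp: H dual_def complete_graph_K_def)
    show "whp_limit p (\<lambda>N es. ereal (real (vertex_counter H es (num_steps H N) v) / real N))
      (real n / (real n - 1))"
      unfolding steps a_def[symmetric]
    proof (rule whp_limitI[OF steady])
      fix \<epsilon> :: real assume \<epsilon>: "0 < \<epsilon>"
      define \<delta> where "\<delta> = \<epsilon> / (6 * 2 ^ n)"
      have \<delta>: "0 < \<delta>" "\<eta> \<delta> = \<epsilon>" using \<epsilon> by (simp_all add: \<delta>_def \<eta>_def)
      have "\<bar>ereal (real (vertex_counter H es (N * n) v) / real N) - ereal a\<bar> \<le> ereal \<epsilon>"
        if N: "0 < N" and es: "es \<in> set_pmf (p N) - unsteady {1..n} (N * n) (\<delta> * real N)" for N es
      proof -
        have "vertex_counter H es (N * n) v = max (state {1..n} es (N * n) i) (state {1..n} es (N * n) j)"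
          using rep[of es N] es ij by (auto simp: represents_def)
        then show ?thesis using near[OF N es ij(2)] near[OF N es ij(3)] \<delta> by (simp add: max_def)
      qed
      then show "\<exists>\<delta>>0. \<forall>N>0. \<forall>es\<in>set_pmf (p N) - unsteady {1..n} (N * n) (\<delta> * real N).
          \<bar>ereal (real (vertex_counter H es (N * n) v) / real N) - ereal a\<bar> \<le> ereal \<epsilon>"
        using \<delta> by blast
    qed
  }
  {
    assume "e \<in> edges H"
    then have e: "e \<in> {1..n}" by (simp add: H edges_dual_complete)
    show "whp_limit p (\<lambda>N es. relative_error H es (num_steps H N) e) (1 / (real n - 1))"
      unfolding steps a(3)
    proof (rule whp_limitI[OF steady])
      fix \<epsilon> :: real assume \<epsilon>: "0 < \<epsilon>"
      \<comment> \<open>The bound 1/2 meets the hypothesis of \<open>ratio_near\<close>, and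
        \<open>\<epsilon> / 6\<close> absorbs the factor 6 in its conclusion.\<close>
      define \<delta> where "\<delta> = min (1 / 2) (\<epsilon> / 6) / (6 * 2 ^ n)"
      have \<delta>: "0 < \<delta>" "\<eta> \<delta> = min (1 / 2) (\<epsilon> / 6)" using \<epsilon> by (simp_all add: \<delta>_def \<eta>_def)
      have \<eta>: "\<eta> \<delta> \<le> 1 / 2" "6 * \<eta> \<delta> \<le> \<epsilon>" using \<delta> by auto
      have "\<bar>relative_error H es (N * n) e - ereal (a - 1)\<bar> \<le> ereal \<epsilon>"
        if N: "0 < N" and es: "es \<in> set_pmf (p N) - unsteady {1..n} (N * n) (\<delta> * real N)" for N es
      proof -
        define x where "x = real (state {1..n} es (N * n) e)"
        define y where "y = real (draw_count es (N * n) e)"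
        have tied: "tied {1..n} (state {1..n} es (N * n))"
          by (rule tied_state) (use n draws[of es N] es in auto)
        have ec: "edge_counter H es (N * n) e = state {1..n} es (N * n) e"
          unfolding edge_counter_def H
          by (rule edge_min_represents[OF tied _ e]) (use rep[of es N] es H in auto)
        have nr: "\<bar>x / real N - a\<bar> \<le> \<eta> \<delta>" "\<bar>y / real N - 1\<bar> \<le> \<eta> \<delta>"
          using near[OF N es e] by (simp_all add: x_def y_def)
        \<comment> \<open>\<open>y / N\<close> is within 1/2 of 1, so the edge has been drawn and
          the infinite value of \<open>relative_error\<close> does not occur.\<close>
        have y: "y \<noteq> 0" using nr(2) \<eta>(1) by auto
        have "\<bar>(x / real N) / (y / real N) - a\<bar> \<le> \<epsilon>"
          using ratio_near[OF nr \<eta>(1) a(1,2)] \<eta>(2) by linarith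
        then have "\<bar>(x - y) / y - (a - 1)\<bar> \<le> \<epsilon>"
          using y N by (simp add: diff_divide_distrib)
        moreover have "relative_error H es (N * n) e = ereal ((x - y) / y)"
          using y by (simp add: relative_error_def ec x_def y_def)
        ultimately show ?thesis by simp
      qed
      then show "\<exists>\<delta>>0. \<forall>N>0. \<forall>es\<in>set_pmf (p N) - unsteady {1..n} (N * n) (\<delta> * real N).
          \<bar>relative_error H es (N * n) e - ereal (a - 1)\<bar> \<le> ereal \<epsilon>"
        using \<delta> by blast
    qed
  }
qed

theorem theorem4:
  fixes n :: nat and H :: "(nat set, nat) hypergraph"
  assumes "n \<ge> 2" and "H = dual (complete_graph_K n)"
  shows "\<forall>model \<in> {uniform_model H, balanced_model H}.
    (\<forall>v \<in> vertices H.
       whp_limit model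
         (\<lambda>N es. ereal (real (vertex_counter H es (num_steps H N) v) / real N))
         (real n / (real n - 1))) \<and>
    (\<forall>e \<in> edges H.
       whp_limit model
         (\<lambda>N es. relative_error H es (num_steps H N) e)
         (1 / (real n - 1)))"
proof -
  have V: "finite {1..n}" "{1..n} \<noteq> {}" using assms(1) by auto
  have E: "edges H = {1..n}" by (simp add: assms(2) edges_dual_complete)
  have U: "uniform_model H N = replicate_pmf (N * n) (pmf_of_set {1..n})" for N
    by (simp add: uniform_model_def num_steps_def E)
  have B: "balanced_model H N = pmf_of_set (permutations_of_multiset (balanced_mset {1..n} N))" for N
    by (simp add: balanced_model_def balanced_mset_def E)
  have setU: "set es \<subseteq> {1..n} \<and> length es = N * n" if "es \<in> set_pmf (uniform_model H N)" for N es
    using that V unfolding U set_replicate_pmf by (auto simp: set_pmf_of_set)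
  have setB: "set es \<subseteq> {1..n} \<and> length es = N * n" if "es \<in> set_pmf (balanced_model H N)" for N es
    using permutations_of_balanced_msetD[OF V(1), of es N] that by (simp add: B)
  show ?thesis
  proof (rule ballI)
    fix model assume model: "model \<in> {uniform_model H, balanced_model H}"
    have draws: "set es \<subseteq> {1..n} \<and> length es = N * n" if "es \<in> set_pmf (model N)" for N es
      using model that setU setB by blast
    have steady: "(\<lambda>N. measure_pmf.prob (model N) (unsteady {1..n} (N * n) (\<delta> * real N))) \<longlonglongrightarrow> 0"
      if "0 < \<delta>" for \<delta> :: real
      using model prob_unsteady_uniform_tendsto_0[OF V that] prob_unsteady_balanced_tendsto_0[OF V that]
      by (auto simp: U B)
    show "(\<forall>v \<in> vertices H. whp_limit model
         (\<lambda>N es. ereal (real (vertex_counter H es (num_steps H N) v) / real N))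
         (real n / (real n - 1))) \<and>
      (\<forall>e \<in> edges H. whp_limit model
         (\<lambda>N es. relative_error H es (num_steps H N) e) (1 / (real n - 1)))"
      using CU_process_dual_complete_whp[OF assms draws steady] by blast
  qed
qed

end
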